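(* Let $m,n\ge 1$ be integers, let $\Delta=\{\mathbf{x}_1,\dots,\mathbf{x}_n\}$ be a set of $n$ distinct points, let $\Gamma_1,\dots,\Gamma_m:\Delta\to\mathbb{R}$ be functions, and let $y_1,\dots,y_n\in\mathbb{R}$. Let $$d:=\min_{\alpha\in\mathbb{R}^m}\ \max_{1\le i\le n}\Big|y_i-\sum_{j=1}^m\alpha_j\Gamma_j(\mathbf{x}_i)\Big| .$$ Assume that the $2n\times(m+1)$ matrix whose rows are $(\Gamma_1(\mathbf{x}_i),\dots,\Gamma_m(\mathbf{x}_i),-1)$ and $(-\Gamma_1(\mathbf{x}_i),\dots,-\Gamma_m(\mathbf{x}_i),-1)$ for $1\le i\le n$ has rank $m+1$, and that there is no exact interpolation, i.e. $d>0$. Suppose that $\Gamma_1$ is the constant function $1$. Then for every optimal coefficient vector $\alpha$ (i.e. every $\alpha\in\mathbb{R}^m$ with $\max_{1\le i\le n}|y_i-\sum_{j=1}^m\alpha_j\Gamma_j(\mathbf{x}_i)|=d$) there is at least one overshoot and at least one undershoot with optimal discrepancy: there exist indices $k,l\in\{1,\dots,n\}$ such that $$\sum_{j=1}^m\alpha_j\Gamma_j(\mathbf{x}_k)-y_k=d\qquad\text{and}\qquad y_l-\sum_{j=1}^m\alpha_j\Gamma_j(\mathbf{x}_l)=d .$$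
   Context: The best approximation problem is equivalent to the linear program in the $m+1$ real variables $\alpha_1,\dots,\alpha_m,z$: minimize $z$ subject to the $2n$ constraints $z\ge \sum_{j=1}^m\alpha_j\Gamma_j(\mathbf{x}_i)-y_i$ and $z\ge y_i-\sum_{j=1}^m\alpha_j\Gamma_j(\mathbf{x}_i)$, $1\le i\le n$. The optimal discrepancy is the optimal value of $z$ in this program, which equals $d$. The $2n\times(m+1)$ matrix in the claim is the constraint matrix of this program. *)

theory Defs
  imports Complex_Main "Jordan_Normal_Form.DL_Rank"
begin

text \<open>
  Points, data and basis functions are indexed from 1: the points are \<open>x 1, \<dots>, x n\<close>, the
  functions \<open>\<Gamma> 1, \<dots>, \<Gamma> m\<close>.  A coefficient vector in \<open>\<real>\<^sup>m\<close> is a function \<open>\<alpha> :: nat \<Rightarrow> real\<close>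
  of which only the values at \<open>1, \<dots>, m\<close> are used.
\<close>

definition approximant :: "nat \<Rightarrow> (nat \<Rightarrow> 'a \<Rightarrow> real) \<Rightarrow> (nat \<Rightarrow> real) \<Rightarrow> 'a \<Rightarrow> real" where
  "approximant m \<Gamma> \<alpha> p = (\<Sum>j=1..m. \<alpha> j * \<Gamma> j p)"

definition discrepancy ::
  "nat \<Rightarrow> nat \<Rightarrow> (nat \<Rightarrow> 'a) \<Rightarrow> (nat \<Rightarrow> 'a \<Rightarrow> real) \<Rightarrow> (nat \<Rightarrow> real) \<Rightarrow> (nat \<Rightarrow> real) \<Rightarrow> real" where
  "discrepancy m n x \<Gamma> y \<alpha> = (MAX i\<in>{1..n}. \<bar>y i - approximant m \<Gamma> \<alpha> (x i)\<bar>)"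

text \<open>
  The infimum is a minimum; see \<open>optimal_discrepancy_attained\<close> and
  \<open>optimal_discrepancy_le\<close> below.
\<close>

definition optimal_discrepancy ::
  "nat \<Rightarrow> nat \<Rightarrow> (nat \<Rightarrow> 'a) \<Rightarrow> (nat \<Rightarrow> 'a \<Rightarrow> real) \<Rightarrow> (nat \<Rightarrow> real) \<Rightarrow> real" where
  "optimal_discrepancy m n x \<Gamma> y = (INF \<alpha>. discrepancy m n x \<Gamma> y \<alpha>)"

text \<open>
  Matrix indices start at 0.  Row \<open>r < n\<close> is \<open>(\<Gamma> 1 (x i), \<dots>, \<Gamma> m (x i), -1)\<close> for
  \<open>i = r + 1\<close>, and row \<open>n + r\<close> is \<open>(- \<Gamma> 1 (x i), \<dots>, - \<Gamma> m (x i), -1)\<close> for the same \<open>i\<close>.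
\<close>

definition constraint_matrix ::
  "nat \<Rightarrow> nat \<Rightarrow> (nat \<Rightarrow> 'a) \<Rightarrow> (nat \<Rightarrow> 'a \<Rightarrow> real) \<Rightarrow> real mat" where
  "constraint_matrix m n x \<Gamma> = mat (2 * n) (m + 1) (\<lambda>(r, c).
     if c = m then - 1
     else if r < n then \<Gamma> (c + 1) (x (r + 1))
     else - \<Gamma> (c + 1) (x (r - n + 1)))"

lemma discrepancy_le_iff:
  assumes "1 \<le> n"
  shows "discrepancy m n x \<Gamma> y \<alpha> \<le> c \<longleftrightarrow>
    (\<forall>i\<in>{1..n}. \<bar>y i - approximant m \<Gamma> \<alpha> (x i)\<bar> \<le> c)"
  using assms unfolding discrepancy_def by (subst Max_le_iff) auto

lemma discrepancy_ge:
  assumes "i \<in> {1..n}"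
  shows "\<bar>y i - approximant m \<Gamma> \<alpha> (x i)\<bar> \<le> discrepancy m n x \<Gamma> y \<alpha>"
  using assms unfolding discrepancy_def by (intro Max_ge) auto

lemma discrepancy_nonneg:
  assumes "1 \<le> n"
  shows "0 \<le> discrepancy m n x \<Gamma> y \<alpha>"
proof -
  have "1 \<in> {1..n}" using assms by simp
  from discrepancy_ge[OF this] show ?thesis
    by (meson abs_ge_zero order_trans)
qed

lemma approximant_Suc:
  "approximant (Suc m) \<Gamma> \<alpha> p = approximant m \<Gamma> \<alpha> p + \<alpha> (Suc m) * \<Gamma> (Suc m) p"
  by (simp add: approximant_def)

lemma approximant_add:
  "approximant m \<Gamma> (\<lambda>j. \<alpha> j + t * \<beta> j) p = approximant m \<Gamma> \<alpha> p + t * approximant m \<Gamma> \<beta> p"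
  by (simp add: approximant_def algebra_simps sum.distrib sum_distrib_left)

lemma approximant_upd:
  "approximant m \<Gamma> (\<alpha>(Suc m := t)) p = approximant m \<Gamma> \<alpha> p"
  by (simp add: approximant_def)

lemma discrepancy_minimizer_exists:
  assumes n: "1 \<le> n"
  shows "\<exists>\<alpha>. \<forall>\<beta>. discrepancy m n x \<Gamma> y \<alpha> \<le> discrepancy m n x \<Gamma> y \<beta>"
proof (induction m arbitrary: y)
  case 0
  show ?case by (simp add: discrepancy_def approximant_def)
next
  case (Suc m)
  define g where "g = (\<lambda>i. \<Gamma> (Suc m) (x i))"
  let ?D = "discrepancy m n x \<Gamma>"
  obtain \<gamma> where \<gamma>: "\<And>\<beta>. ?D g \<gamma> \<le> ?D g \<beta>"
    using Suc.IH by blast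
  define s where "s = (\<lambda>t i. y i - t * g i)"
  have "\<forall>t. \<exists>\<alpha>. \<forall>\<beta>. ?D (s t) \<alpha> \<le> ?D (s t) \<beta>"
    using Suc.IH by blast
  then obtain A where A: "\<And>t \<beta>. ?D (s t) (A t) \<le> ?D (s t) \<beta>"
    by metis
  have step: "discrepancy (Suc m) n x \<Gamma> y \<alpha> = ?D (s (\<alpha> (Suc m))) \<alpha>" for \<alpha>
    by (simp add: discrepancy_def approximant_Suc s_def g_def algebra_simps)
  have upd: "?D z (\<alpha>(Suc m := t)) = ?D z \<alpha>" for z \<alpha> t
    by (simp add: discrepancy_def approximant_upd)
  define N where "N = (\<lambda>t. ?D (s t) (A t))"
  have red: "?case" if t: "\<And>u. N t \<le> N u" for t
  proof (intro exI allI)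
    fix \<beta>
    have "discrepancy (Suc m) n x \<Gamma> y ((A t)(Suc m := t)) = N t"
      by (simp add: step upd N_def)
    also have "\<dots> \<le> N (\<beta> (Suc m))" by (rule t)
    also have "\<dots> \<le> discrepancy (Suc m) n x \<Gamma> y \<beta>"
      by (simp add: step N_def A)
    finally show "discrepancy (Suc m) n x \<Gamma> y ((A t)(Suc m := t)) \<le> discrepancy (Suc m) n x \<Gamma> y \<beta>" .
  qed
  define G where "G = ?D g (\<lambda>_. 0)"
  have G: "\<bar>g i\<bar> \<le> G" if "i \<in> {1..n}" for i
    using discrepancy_ge[OF that, of g m \<Gamma> "\<lambda>_. 0" x] by (simp add: G_def approximant_def)
  have lip: "N u \<le> N t + \<bar>u - t\<bar> * G" for t u
  proof -
    have "?D (s u) (A t) \<le> N t + \<bar>u - t\<bar> * G"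
      unfolding discrepancy_le_iff[OF n]
    proof
      fix i assume i: "i \<in> {1..n}"
      have "\<bar>s t i - approximant m \<Gamma> (A t) (x i)\<bar> \<le> N t"
        unfolding N_def by (rule discrepancy_ge[OF i])
      moreover have "\<bar>(u - t) * g i\<bar> \<le> \<bar>u - t\<bar> * G"
        unfolding abs_mult by (intro mult_left_mono G i) simp
      moreover have "s u i = s t i - (u - t) * g i"
        by (simp add: s_def algebra_simps)
      ultimately show "\<bar>s u i - approximant m \<Gamma> (A t) (x i)\<bar> \<le> N t + \<bar>u - t\<bar> * G"
        by linarith
    qed
    with A[of u "A t"] show ?thesis unfolding N_def by linarith
  qed
  show ?case
  proof (cases "?D g \<gamma> = 0")
    case True
    have zero: "approximant m \<Gamma> \<gamma> (x i) = g i" if "i \<in> {1..n}" for i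
      using discrepancy_ge[OF that, of g m \<Gamma> \<gamma> x] True by simp
    have "N 0 \<le> N u" for u
    proof -
      have "N 0 \<le> ?D (s 0) (\<lambda>j. A u j + u * \<gamma> j)"
        unfolding N_def by (rule A)
      also have "\<dots> \<le> N u"
        unfolding discrepancy_le_iff[OF n]
      proof
        fix i assume i: "i \<in> {1..n}"
        have "s 0 i - approximant m \<Gamma> (\<lambda>j. A u j + u * \<gamma> j) (x i)
            = s u i - approximant m \<Gamma> (A u) (x i)"
          by (simp add: approximant_add zero[OF i] s_def)
        then show "\<bar>s 0 i - approximant m \<Gamma> (\<lambda>j. A u j + u * \<gamma> j) (x i)\<bar> \<le> N u"
          using discrepancy_ge[OF i, of "s u" m \<Gamma> "A u" x] by (simp add: N_def)
      qed
      finally show ?thesis .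
    qed
    then show ?thesis by (rule red)
  next
    case False
    define e where "e = ?D g \<gamma>"
    have e: "0 < e"
      using False discrepancy_nonneg[OF n, of m x \<Gamma> g \<gamma>] by (simp add: e_def)
    define Y where "Y = ?D y (\<lambda>_. 0)"
    have Y: "\<bar>y i\<bar> \<le> Y" if "i \<in> {1..n}" for i
      using discrepancy_ge[OF that, of y m \<Gamma> "\<lambda>_. 0" x] by (simp add: Y_def approximant_def)
    have coercive: "\<bar>t\<bar> * e \<le> N t + Y" for t
    proof (cases "t = 0")
      case True
      then show ?thesis
        using discrepancy_nonneg[OF n, of m x \<Gamma> "s t" "A t"]
          discrepancy_nonneg[OF n, of m x \<Gamma> y "\<lambda>_. 0"] by (simp add: N_def Y_def)
    next
      case False
      define \<beta> where "\<beta> = (\<lambda>j. 0 + (- 1 / t) * A t j)"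
      have \<beta>: "approximant m \<Gamma> \<beta> p = - approximant m \<Gamma> (A t) p / t" for p
        unfolding \<beta>_def approximant_add by (simp add: approximant_def)
      have "?D g \<beta> \<le> (N t + Y) / \<bar>t\<bar>"
        unfolding discrepancy_le_iff[OF n]
      proof
        fix i assume i: "i \<in> {1..n}"
        have "\<bar>s t i - approximant m \<Gamma> (A t) (x i)\<bar> \<le> N t"
          unfolding N_def by (rule discrepancy_ge[OF i])
        moreover have "t * (g i - approximant m \<Gamma> \<beta> (x i)) =
            y i - (s t i - approximant m \<Gamma> (A t) (x i))"
          using False by (simp add: \<beta> s_def field_simps)
        ultimately have "\<bar>t * (g i - approximant m \<Gamma> \<beta> (x i))\<bar> \<le> N t + Y"
          using Y[OF i] by linarith
        then show "\<bar>g i - approximant m \<Gamma> \<beta> (x i)\<bar> \<le> (N t + Y) / \<bar>t\<bar>"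
          using False by (simp only: abs_mult) (simp add: pos_le_divide_eq mult.commute)
      qed
      with \<gamma>[of \<beta>] have "e \<le> (N t + Y) / \<bar>t\<bar>" by (simp add: e_def)
      then show ?thesis using False by (simp add: field_simps)
    qed
    define R where "R = (N 0 + Y) / e"
    have R: "0 \<le> R"
      using coercive[of 0] e by (simp add: R_def)
    have G0: "0 \<le> G" unfolding G_def by (rule discrepancy_nonneg[OF n])
    have "continuous_on {- R..R} N"
    proof (intro continuous_at_imp_continuous_on ballI)
      fix t
      show "isCont N t"
        unfolding isCont_def LIM_def
      proof (intro allI impI)
        fix r :: real assume r: "0 < r"
        show "\<exists>\<delta>>0. \<forall>u. u \<noteq> t \<and> dist u t < \<delta> \<longrightarrow> dist (N u) (N t) < r"
        proof (intro exI[of _ "r / (G + 1)"] conjI allI impI)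
          show "0 < r / (G + 1)" using r G0 by simp
          fix u assume "u \<noteq> t \<and> dist u t < r / (G + 1)"
          then have "\<bar>u - t\<bar> * (G + 1) < r"
            using G0 by (simp add: dist_real_def field_simps)
          moreover have "\<bar>u - t\<bar> * G \<le> \<bar>u - t\<bar> * (G + 1)"
            by (intro mult_left_mono) auto
          moreover have "\<bar>t - u\<bar> = \<bar>u - t\<bar>" by simp
          ultimately show "dist (N u) (N t) < r"
            using lip[of u t] lip[of t u] unfolding dist_real_def by (smt (verit))
        qed
      qed
    qed
    moreover have "compact {- R..R}" by (rule compact_Icc)
    moreover have "{- R..R} \<noteq> {}" using R by simp
    ultimately obtain t where t: "t \<in> {- R..R}" "\<And>u. u \<in> {- R..R} \<Longrightarrow> N t \<le> N u"
      using continuous_attains_inf by metis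
    have "N t \<le> N u" for u
    proof (cases "u \<in> {- R..R}")
      case True
      then show ?thesis by (rule t)
    next
      case False
      then have "R < \<bar>u\<bar>" by auto
      then have "N 0 + Y < \<bar>u\<bar> * e" using e by (simp add: R_def field_simps)
      with coercive[of u] t(2)[of 0] R show ?thesis by simp
    qed
    then show ?thesis by (rule red)
  qed
qed

lemma optimal_discrepancy_le:
  assumes "1 \<le> n"
  shows "optimal_discrepancy m n x \<Gamma> y \<le> discrepancy m n x \<Gamma> y \<alpha>"
  unfolding optimal_discrepancy_def
  by (intro cINF_lower bdd_belowI2[where m = 0] discrepancy_nonneg[OF assms]) simp

lemma optimal_discrepancy_attained:
  assumes "1 \<le> n"
  shows "\<exists>\<alpha>. discrepancy m n x \<Gamma> y \<alpha> = optimal_discrepancy m n x \<Gamma> y"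
proof -
  obtain \<alpha> where "\<And>\<beta>. discrepancy m n x \<Gamma> y \<alpha> \<le> discrepancy m n x \<Gamma> y \<beta>"
    using discrepancy_minimizer_exists[OF assms] by blast
  then have "discrepancy m n x \<Gamma> y \<alpha> \<le> optimal_discrepancy m n x \<Gamma> y"
    unfolding optimal_discrepancy_def by (intro cINF_greatest) auto
  with optimal_discrepancy_le[OF assms] show ?thesis
    by (intro exI[of _ \<alpha>] antisym)
qed

end

theory Submission
  imports Defs
begin

text \<open>
  If no residual reaches \<open>d\<close> from one side, adding a small constant to the approximant, which
  is possible because \<open>\<Gamma> 1\<close> is constant, moves every residual strictly inside \<open>(-d, d)\<close> and so
  contradicts optimality.
\<close>

text \<open>One-sided so that it serves twice: residuals \<open>e\<close> yield the undershoot,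
  their negatives the overshoot. Values in [-d, d] that stay below d leave a gap at the top, and a
  small upward shift would then make all absolute values smaller than d.\<close>

lemma bound_attained_if_translates_large:
  fixes e :: "'i \<Rightarrow> real"
  assumes "finite I" "I \<noteq> {}"
    and bound: "\<And>i. i \<in> I \<Longrightarrow> \<bar>e i\<bar> \<le> d"
    and large: "\<And>t. \<exists>i\<in>I. d \<le> \<bar>e i + t\<bar>"
  shows "\<exists>i\<in>I. e i = d"
proof -
  define M where "M = Max (e ` I)"
  have M: "e i \<le> M" if "i \<in> I" for i
    using assms(1) that by (simp add: M_def)
  have "M \<in> e ` I"
    unfolding M_def using assms(1,2) by (intro Max_in) auto
  then obtain k where k: "k \<in> I" "e k = M" by auto
  \<comment> \<open>The shift is half the gap between M and d. If M < d, shifted values are at most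
    (M + d) / 2 < d and at least -d + (d - M) / 2 > -d, so no index i could exist.\<close>
  obtain i where i: "i \<in> I" "d \<le> \<bar>e i + (d - M) / 2\<bar>"
    using large by blast
  have "M = d"
    using bound[OF k(1)] k(2) bound[OF i(1)] M[OF i(1)] i(2) by (simp add: abs_if field_simps split: if_splits)
  with k show ?thesis by blast
qed

lemma approximant_add_const:
  assumes "1 \<le> m" "\<Gamma> 1 p = 1"
  shows "approximant m \<Gamma> (\<alpha>(1 := \<alpha> 1 + t)) p = approximant m \<Gamma> \<alpha> p + t"
proof -
  have "approximant m \<Gamma> (\<alpha>(1 := \<alpha> 1 + t)) p
      = (\<Sum>j=1..m. \<alpha> j * \<Gamma> j p + (if j = 1 then t else 0))"
    unfolding approximant_def by (intro sum.cong) (auto simp: assms(2)[simplified] algebra_simps)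
  \<comment> \<open>As \<open>1 \<le> m\<close>, index 1 lies in the range of summation, so the
    indicator terms sum to exactly t.\<close>
  also have "\<dots> = approximant m \<Gamma> \<alpha> p + t"
    using assms(1) by (simp add: approximant_def sum.distrib)
  finally show ?thesis .
qed

theorem theorem3p2:
  fixes m n :: nat
    and \<Delta> :: "'a set"
    and x :: "nat \<Rightarrow> 'a"
    and \<Gamma> :: "nat \<Rightarrow> 'a \<Rightarrow> real"
    and y :: "nat \<Rightarrow> real"
    and d :: real
  assumes "1 \<le> m" and "1 \<le> n"
    and "inj_on x {1..n}" and "\<Delta> = x ` {1..n}"
    and "d = optimal_discrepancy m n x \<Gamma> y"
    and "vec_space.rank (2 * n) (constraint_matrix m n x \<Gamma>) = m + 1"
    and "d > 0"
    and "\<forall>p\<in>\<Delta>. \<Gamma> 1 p = 1"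
  shows "\<forall>\<alpha> :: nat \<Rightarrow> real. discrepancy m n x \<Gamma> y \<alpha> = d \<longrightarrow>
    (\<exists>k\<in>{1..n}. \<exists>l\<in>{1..n}.
      approximant m \<Gamma> \<alpha> (x k) - y k = d \<and> y l - approximant m \<Gamma> \<alpha> (x l) = d)"
proof (intro allI impI)
  fix \<alpha> :: "nat \<Rightarrow> real"
  assume opt: "discrepancy m n x \<Gamma> y \<alpha> = d"
  define e where "e i = y i - approximant m \<Gamma> \<alpha> (x i)" for i
  have ne: "{1..n} \<noteq> {}" using \<open>1 \<le> n\<close> by simp
  have bound: "\<bar>e i\<bar> \<le> d" if "i \<in> {1..n}" for i
    using discrepancy_ge[OF that, of y m \<Gamma> \<alpha> x] opt by (simp add: e_def)
  \<comment> \<open>Moving the first coefficient by t gives a competitor with residuals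
    \<open>e i - t\<close>. Its discrepancy is at least d by optimality and, as a maximum over a
    finite set, is attained at some index.\<close>
  have large: "\<exists>i\<in>{1..n}. d \<le> \<bar>e i - t\<bar>" for t
  proof -
    let ?\<beta> = "\<alpha>(1 := \<alpha> 1 + t)"
    have "discrepancy m n x \<Gamma> y ?\<beta> \<in> (\<lambda>i. \<bar>y i - approximant m \<Gamma> ?\<beta> (x i)\<bar>) ` {1..n}"
      unfolding discrepancy_def using ne by (intro Max_in) auto
    then obtain i where i: "i \<in> {1..n}"
        "discrepancy m n x \<Gamma> y ?\<beta> = \<bar>y i - approximant m \<Gamma> ?\<beta> (x i)\<bar>"
      by blast
    have "\<Gamma> 1 (x i) = 1" using i(1) assms(4,8) by blast
    then have "y i - approximant m \<Gamma> ?\<beta> (x i) = e i - t"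
      using approximant_add_const[where \<Gamma> = \<Gamma>, OF \<open>1 \<le> m\<close>] by (simp add: e_def)
    moreover have "d \<le> discrepancy m n x \<Gamma> y ?\<beta>"
      unfolding assms(5) by (rule optimal_discrepancy_le[OF \<open>1 \<le> n\<close>])
    ultimately show ?thesis using i by auto
  qed
  \<comment> \<open>Overshoot: the family -e has the same absolute bound, and |-e i + t| = |e i -
    t|.\<close>
  have "\<exists>k\<in>{1..n}. - e k = d"
  proof (rule bound_attained_if_translates_large)
    show "\<exists>i\<in>{1..n}. d \<le> \<bar>- e i + t\<bar>" for t
      using large[of t] by (simp add: abs_minus_commute)
  qed (use ne bound in auto)
  \<comment> \<open>Undershoot: here the coefficient moves by -t instead.\<close>
  moreover have "\<exists>l\<in>{1..n}. e l = d"
  proof (rule bound_attained_if_translates_large)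
    show "\<exists>i\<in>{1..n}. d \<le> \<bar>e i + t\<bar>" for t
      using large[of "- t"] by simp
  qed (use ne bound in auto)
  ultimately show "\<exists>k\<in>{1..n}. \<exists>l\<in>{1..n}.
      approximant m \<Gamma> \<alpha> (x k) - y k = d \<and> y l - approximant m \<Gamma> \<alpha> (x l) = d"
    by (auto simp: e_def)
qed

end
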